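(* Let $\mathcal{E}_0$ and $\mathcal{E}_1$ be linear homogeneous equations with integer coefficients. Assume that $\mathcal{E}_0$ and $\mathcal{E}_1$ each have at least $3$ variables (each variable occurring with nonzero coefficient), and that each of them has both positive and negative coefficients. Then for any $2$-coloring $\chi:\mathbb{Z}^+\to\{0,1\}$, either there is a solution to $\mathcal{E}_0$ in positive integers all of whose entries have color $0$, or there is a solution to $\mathcal{E}_1$ in positive integers all of whose entries have color $1$.
   Context: A linear homogeneous equation in the variables $x_1,\dots,x_n$ is written as $\sum_{i=1}^n a_i x_i=0$ with $a_i\in\mathbb{Z}$. Solutions are tuples of (not necessarily distinct) positive integers. The two equations may have different numbers of variables. *)

theory Defs
  imports Main "HOL-Library.FuncSet"
begin

text \<open>
  The equation \<open>a\<^sub>1 x\<^sub>1 + \<dots> + a\<^sub>n x\<^sub>n = 0\<close> is given by \<open>n\<close> and \<open>a :: nat \<Rightarrow> int\<close>; only the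
  values of \<open>a\<close> and \<open>x\<close> on \<open>{1..n}\<close> are relevant. Entries of a solution need not be distinct.
\<close>

definition pos_solution :: "nat \<Rightarrow> (nat \<Rightarrow> int) \<Rightarrow> (nat \<Rightarrow> nat) \<Rightarrow> bool" where
  "pos_solution n a x \<longleftrightarrow>
     (\<forall>i\<in>{1..n}. x i > 0) \<and> (\<Sum>i=1..n. a i * int (x i)) = 0"

end

theory Submission
  imports Defs
begin

text \<open>
  Merging variables reduces both equations to the shapes \<open>a x + b y = c z\<close> and
  \<open>d x + e y = f z\<close> with positive coefficients. Suppose that \<open>A\<close> (color 0) contains no solution
  of the first and its complement no solution of the second. For fixed \<open>p \<in> A\<close> and \<open>q \<notin> A\<close>, the
  affine maps \<open>\<phi> y = (b y + a p) / c\<close> and \<open>\<psi> y = (e y + d q) / f\<close> and their inverses satisfy: \<open>\<phi>\<close>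
  and \<open>\<phi>\<^sup>-\<^sup>1\<close> send \<open>A\<close> to its complement, \<open>\<psi>\<close> and \<open>\<psi>\<^sup>-\<^sup>1\<close> send the complement to \<open>A\<close>. Hence \<open>A\<close> is
  closed under the commutator of \<open>\<psi>\<close> and \<open>\<phi>\<close>, which is a translation, and which is nontrivial for
  suitable \<open>p\<close>, \<open>q\<close> unless \<open>b = c\<close> and \<open>e = f\<close>; in that case \<open>\<psi> \<circ> \<phi>\<close> is itself a nontrivial
  translation. So the color is constant on large multiples of some number, and a
  scaled solution of one of the equations lies among them.
\<close>

lemma eventually_constant_if_step:
  fixes R :: "int \<Rightarrow> bool"
  assumes "N > 0" and step: "\<And>k. k \<ge> N \<Longrightarrow> R k \<Longrightarrow> R (k + 1)"
  shows "\<exists>M>0. (\<forall>k\<ge>M. R k) \<or> (\<forall>k\<ge>M. \<not> R k)"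
proof (cases "\<exists>k\<ge>N. R k")
  case True
  then obtain M where M: "M \<ge> N" "R M" by blast
  have "R k" if "k \<ge> M" for k
    using that by (induction k rule: int_ge_induct) (use M step in auto)
  with M \<open>N > 0\<close> show ?thesis by (intro exI[of _ M]) auto
qed (use \<open>N > 0\<close> in blast)

text \<open>Along the multiples of \<open>g * \<bar>\<delta>\<bar>\<close> the hypothesis
  \<open>shift\<close> is a step by one, so membership can change only finitely often beyond the
  threshold.\<close>

lemma constant_on_multiples_if_shift:
  fixes A :: "int set"
  assumes "g > 0" and "\<delta> \<noteq> 0"
    and shift: "\<And>u. u > L \<Longrightarrow> g * u \<in> A \<Longrightarrow> g * (u + \<delta>) \<in> A"
  shows "\<exists>K>0. (\<forall>k>0. K * k \<in> A) \<or> (\<forall>k>0. K * k \<notin> A)"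
proof -
  define N where "N = max 1 (L + 1)"
  define R where "R k \<longleftrightarrow> g * (\<bar>\<delta>\<bar> * k) \<in> A" for k
  have N: "N > 0" "N > L" by (auto simp: N_def)
  have large: "\<bar>\<delta>\<bar> * k > L" if "k \<ge> N" for k
  proof -
    have "1 * k \<le> \<bar>\<delta>\<bar> * k" using that N \<open>\<delta> \<noteq> 0\<close> by (intro mult_right_mono) auto
    with that N show ?thesis by linarith
  qed
  have "\<exists>M>0. (\<forall>k\<ge>M. R k) \<or> (\<forall>k\<ge>M. \<not> R k)"
  proof (cases "\<delta> > 0")
    case True
    show ?thesis
    proof (rule eventually_constant_if_step[OF N(1)])
      fix k assume "k \<ge> N" "R k"
      with shift[OF large, of k] True show "R (k + 1)" by (simp add: R_def algebra_simps)
    qed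
  next
    case False
    \<comment> \<open>For negative \<open>\<delta>\<close> the shift leads downwards; by
      contraposition, it is non-membership that propagates upwards.\<close>
    have "\<exists>M>0. (\<forall>k\<ge>M. \<not> R k) \<or> (\<forall>k\<ge>M. \<not> \<not> R k)"
    proof (rule eventually_constant_if_step[OF N(1)])
      fix k assume "k \<ge> N" "\<not> R k"
      moreover have "R k" if "R (k + 1)"
        using shift[OF large, of "k + 1"] that False \<open>k \<ge> N\<close> by (simp add: R_def algebra_simps)
      ultimately show "\<not> R (k + 1)" by blast
    qed
    then show ?thesis by blast
  qed
  then obtain M where M: "M > 0" "(\<forall>k\<ge>M. R k) \<or> (\<forall>k\<ge>M. \<not> R k)" by blast
  have le: "M \<le> M * k" if "k > 0" for k
    using mult_left_mono[of 1 k M] that M(1) by simp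
  have eq: "g * \<bar>\<delta>\<bar> * M * k \<in> A \<longleftrightarrow> R (M * k)" for k
    by (simp add: R_def mult.assoc)
  \<comment> \<open>This is the witness \<open>K\<close>: positive multiples of \<open>M\<close> are
    at least \<open>M\<close>, so the extra factor removes the word "eventually".\<close>
  have "g * \<bar>\<delta>\<bar> * M > 0" using M(1) assms(1,2) by simp
  with M(2) le eq show ?thesis by blast
qed

text \<open>Positivity is demanded of the entries, not of \<open>S\<close>, so that the plain
  complement \<open>- A\<close> can serve as the other color class.\<close>

definition solution_free :: "int \<Rightarrow> int \<Rightarrow> int \<Rightarrow> int set \<Rightarrow> bool" where
  "solution_free a b c S \<longleftrightarrow>
     (\<forall>x\<in>S. \<forall>y\<in>S. \<forall>z\<in>S. x > 0 \<longrightarrow> y > 0 \<longrightarrow> z > 0 \<longrightarrow> a * x + b * y \<noteq> c * z)"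

lemma solution_freeD:
  assumes "solution_free a b c S" "a * x + b * y = c * z" "x > 0" "y > 0" "z > 0"
  shows "x \<notin> S \<or> y \<notin> S \<or> z \<notin> S"
  using assms unfolding solution_free_def by blast

text \<open>The multiples of \<open>K\<close> contain the solution
  \<open>(K * c, K * c, K * (a + b))\<close>.\<close>

lemma solution_free_multiple_notin:
  fixes a b c K :: int
  assumes "solution_free a b c S" "a > 0" "b > 0" "c > 0" "K > 0"
  shows "\<exists>k>0. K * k \<notin> S"
proof -
  have "a * (K * c) + b * (K * c) = c * (K * (a + b))" by (simp add: algebra_simps)
  moreover have "K * c > 0" "K * (a + b) > 0" using assms by simp_all
  ultimately have "K * c \<notin> S \<or> K * (a + b) \<notin> S"
    using solution_freeD[OF assms(1)] by blast
  then show ?thesis using assms by (meson add_pos_pos)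
qed

text \<open>From \<open>b * e * u\<close>, the inverses of \<open>\<phi>\<close> and
  \<open>\<psi>\<close>, then \<open>\<phi>\<close> and \<open>\<psi>\<close>, lead through
  \<open>w1\<close>, \<open>w2\<close>, \<open>w3\<close> to \<open>w4\<close>. The factor
  \<open>c * f * b * e\<close> in the fixed entries makes all divisions exact, and the bound on
  \<open>u\<close> keeps all values positive.\<close>

lemma shift_by_commutator:
  fixes a b c d e f p q u :: int
  assumes pos: "a > 0" "b > 0" "c > 0" "d > 0" "e > 0" "f > 0" "p > 0" "q > 0"
    and free: "solution_free a b c A" "solution_free d e f (- A)"
    and p: "c * f * b * e * p \<in> A" and q: "c * f * b * e * q \<notin> A"
    and u: "u > b * d * q + f * a * p" "b * e * u \<in> A"
  shows "b * e * (u + (a * p * (e - f) + d * q * (c - b))) \<in> A"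
proof -
  define v where "v = u - b * d * q - f * a * p"
  define w1 where "w1 = c * (e * v + d * b * e * q)"
  define w2 where "w2 = c * f * v"
  define w3 where "w3 = f * (b * v + a * b * e * p)"
  define w4 where "w4 = b * e * (u + (a * p * (e - f) + d * q * (c - b)))"
  have v: "v > 0" using u by (simp add: v_def)
  have w4: "w4 = b * e * (v + a * p * e + d * q * c)"
    by (simp add: w4_def v_def algebra_simps)
  have "b * d * q + f * a * p > 0" using pos by (simp add: add_pos_pos)
  then have "u > 0" using u(1) by linarith
  have gt0: "w1 > 0" "w2 > 0" "w3 > 0" "w4 > 0"
    using v pos by (simp_all add: w1_def w2_def w3_def w4 add_pos_pos)
  have P: "c * f * b * e * p > 0" "c * f * b * e * q > 0" "b * e * u > 0"
    using pos \<open>u > 0\<close> by simp_all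
  have "w1 \<notin> A"
    using solution_freeD[OF free(1), of "c * f * b * e * p" w1 "b * e * u"] gt0 P p u
    by (simp add: w1_def v_def algebra_simps)
  then have "w2 \<in> A"
    using solution_freeD[OF free(2), of "c * f * b * e * q" w2 w1] gt0 P q
    by (simp add: w1_def w2_def algebra_simps)
  then have "w3 \<notin> A"
    using solution_freeD[OF free(1), of "c * f * b * e * p" w2 w3] gt0 P p
    by (simp add: w2_def w3_def algebra_simps)
  then have "w4 \<in> A"
    using solution_freeD[OF free(2), of "c * f * b * e * q" w3 w4] gt0 P q
    by (simp add: w3_def w4 algebra_simps)
  then show ?thesis by (simp add: w4_def)
qed

lemma exists_shift:
  fixes a b c d e f :: int
  assumes pos: "a > 0" "b > 0" "c > 0" "d > 0" "e > 0" "f > 0"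
    and free: "solution_free a b c A" "solution_free d e f (- A)"
  shows "\<exists>g \<delta> L. g > 0 \<and> \<delta> \<noteq> 0 \<and> (\<forall>u>L. g * u \<in> A \<longrightarrow> g * (u + \<delta>) \<in> A)"
proof (cases "b = c \<and> e = f")
  case True
  \<comment> \<open>With the entries \<open>b * p\<close> and \<open>e * q\<close>, the two maps are
    the integer translations by \<open>a * p\<close> and \<open>d * q\<close>.\<close>
  obtain p q where pq: "p > 0" "b * p \<in> A" "q > 0" "e * q \<notin> A"
    using solution_free_multiple_notin[OF free(1) pos(1-3) \<open>e > 0\<close>]
      solution_free_multiple_notin[OF free(2) pos(4-6) \<open>b > 0\<close>] by auto
  have gt0: "a * p > 0" "d * q > 0" "b * p > 0" "e * q > 0" using pos pq by simp_all
  have "u + (a * p + d * q) \<in> A" if "u > 0" "u \<in> A" for u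
  proof -
    have "u + a * p \<notin> A"
      using solution_freeD[OF free(1), of "b * p" u "u + a * p"] that gt0 pq True
      by (simp add: algebra_simps)
    then show ?thesis
      using solution_freeD[OF free(2), of "e * q" "u + a * p" "u + a * p + d * q"] that gt0 pq True
      by (simp add: algebra_simps)
  qed
  with gt0 show ?thesis
    by (intro exI[of _ 1] exI[of _ "a * p + d * q"] exI[of _ 0]) auto
next
  case False
  define K where "K = c * f * b * e"
  define \<delta> where "\<delta> p q = a * p * (e - f) + d * q * (c - b)" for p q
  have "K > 0" using pos by (simp add: K_def)
  obtain p q where pq: "p > 0" "K * p \<in> A" "q > 0" "K * q \<notin> A"
    using solution_free_multiple_notin[OF free(1) pos(1-3) \<open>K > 0\<close>]
      solution_free_multiple_notin[OF free(2) pos(4-6) \<open>K > 0\<close>] by auto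
  \<comment> \<open>The translation vanishes for at most one ratio of \<open>p\<close> and \<open>q\<close>, so replacing the one that
    has the color of \<open>p + q\<close> by \<open>p + q\<close> makes it nonzero.\<close>
  have "\<exists>p q. p > 0 \<and> K * p \<in> A \<and> q > 0 \<and> K * q \<notin> A \<and> \<delta> p q \<noteq> 0"
  proof (cases "\<delta> p q = 0")
    case True
    have "a * p \<noteq> 0" "d * q \<noteq> 0" using pos pq by auto
    \<comment> \<open>If one difference were zero, the vanishing of \<open>\<delta> p q\<close>
      would make the other zero too, contrary to the case assumption.\<close>
    then have ne: "e - f \<noteq> 0" "c - b \<noteq> 0"
      using False True by (auto simp: \<delta>_def)
    have "\<delta> (p + q) q = \<delta> p q + a * q * (e - f)" "\<delta> p (p + q) = \<delta> p q + d * p * (c - b)"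
      by (simp_all add: \<delta>_def algebra_simps)
    then have "\<delta> (p + q) q \<noteq> 0" "\<delta> p (p + q) \<noteq> 0"
      using True ne pos pq by auto
    then show ?thesis using pq add_pos_pos[OF pq(1,3)] by blast
  qed (use pq in blast)
  then obtain p q where pq: "p > 0" "K * p \<in> A" "q > 0" "K * q \<notin> A" "\<delta> p q \<noteq> 0" by blast
  have "b * e * (u + \<delta> p q) \<in> A" if "u > b * d * q + f * a * p" "b * e * u \<in> A" for u
    using shift_by_commutator[OF pos pq(1,3) free _ _ that] pq by (simp add: K_def \<delta>_def)
  moreover have "b * e > 0" using pos by simp
  ultimately show ?thesis using pq(5) by blast
qed

lemma not_both_solution_free:
  fixes a b c d e f :: int
  assumes pos: "a > 0" "b > 0" "c > 0" "d > 0" "e > 0" "f > 0"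
  shows "\<not> (solution_free a b c A \<and> solution_free d e f (- A))"
proof
  assume "solution_free a b c A \<and> solution_free d e f (- A)"
  then have free: "solution_free a b c A" "solution_free d e f (- A)" by simp_all
  obtain g \<delta> L where "g > 0" "\<delta> \<noteq> 0" "\<And>u. u > L \<Longrightarrow> g * u \<in> A \<Longrightarrow> g * (u + \<delta>) \<in> A"
    using exists_shift[OF pos free] by blast
  then obtain K where "K > 0" "(\<forall>k>0. K * k \<in> A) \<or> (\<forall>k>0. K * k \<notin> A)"
    using constant_on_multiples_if_shift[of g \<delta> L A] by blast
  then show False
    using solution_free_multiple_notin[OF free(1) pos(1-3) \<open>K > 0\<close>]
      solution_free_multiple_notin[OF free(2) pos(4-6) \<open>K > 0\<close>] by auto
qed

text \<open>The entries of \<open>w\<close> are confined to \<open>x\<close>, \<open>y\<close>,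
  \<open>z\<close> so that a monochromatic solution stays monochromatic.\<close>

definition reduces_to :: "nat \<Rightarrow> (nat \<Rightarrow> int) \<Rightarrow> int \<Rightarrow> int \<Rightarrow> int \<Rightarrow> bool" where
  "reduces_to n \<alpha> a b c \<longleftrightarrow>
     (\<forall>x y z. x > 0 \<longrightarrow> y > 0 \<longrightarrow> z > 0 \<longrightarrow> a * int x + b * int y = c * int z \<longrightarrow>
       (\<exists>w. pos_solution n \<alpha> w \<and> range w \<subseteq> {x, y, z}))"

text \<open>Variable \<open>i\<close> takes the value \<open>x\<close>, the other variables with
  positive coefficient take \<open>y\<close>, those with negative coefficient take \<open>z\<close>.
  The indices \<open>j\<close> and \<open>l\<close> make both coefficient sums nonempty, hence
  positive after the sign change.\<close>

lemma three_variable_reduction_two_pos: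
  fixes \<alpha> :: "nat \<Rightarrow> int"
  assumes i: "i \<in> {1..n}" "\<alpha> i > 0" and j: "j \<in> {1..n}" "\<alpha> j > 0" "j \<noteq> i"
    and l: "l \<in> {1..n}" "\<alpha> l < 0" and nz: "\<forall>k\<in>{1..n}. \<alpha> k \<noteq> 0"
  shows "\<exists>a b c. a > 0 \<and> b > 0 \<and> c > 0 \<and> reduces_to n \<alpha> a b c"
proof -
  define P where "P = {k \<in> {1..n}. \<alpha> k > 0} - {i}"
  define N where "N = {k \<in> {1..n}. \<alpha> k < 0}"
  have fin: "finite P" "finite N" by (simp_all add: P_def N_def)
  have split: "{1..n} = insert i (P \<union> N)"
    using nz i by (auto simp: P_def N_def)
  have disj: "i \<notin> P \<union> N" "P \<inter> N = {}" using i by (auto simp: P_def N_def)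
  have pos: "sum \<alpha> P > 0" "(\<Sum>k\<in>N. - \<alpha> k) > 0"
    by (rule sum_pos2[of _ j]; use fin j in \<open>auto simp: P_def\<close>)
      (rule sum_pos2[of _ l]; use fin l in \<open>auto simp: N_def\<close>)
  have "\<exists>w. pos_solution n \<alpha> w \<and> range w \<subseteq> {x, y, z}"
    if xyz: "x > 0" "y > 0" "z > 0"
      and eq: "\<alpha> i * int x + sum \<alpha> P * int y = (\<Sum>k\<in>N. - \<alpha> k) * int z" for x y z :: nat
  proof -
    define w where "w k = (if k = i then x else if \<alpha> k > 0 then y else z)" for k
    have "(\<Sum>k\<in>P. \<alpha> k * int (w k)) = sum \<alpha> P * int y"
      unfolding sum_distrib_right by (rule sum.cong) (auto simp: w_def P_def)
    moreover have "(\<Sum>k\<in>N. \<alpha> k * int (w k)) = sum \<alpha> N * int z"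
      unfolding sum_distrib_right by (rule sum.cong) (use i in \<open>auto simp: w_def N_def\<close>)
    ultimately have "(\<Sum>k=1..n. \<alpha> k * int (w k)) = 0"
      unfolding split using fin disj eq
      by (simp add: sum.union_disjoint sum_negf w_def[of i])
    then have "pos_solution n \<alpha> w" using xyz by (auto simp: pos_solution_def w_def)
    moreover have "range w \<subseteq> {x, y, z}" by (auto simp: w_def)
    ultimately show ?thesis by blast
  qed
  then have reduces: "reduces_to n \<alpha> (\<alpha> i) (sum \<alpha> P) (\<Sum>k\<in>N. - \<alpha> k)"
    by (simp add: reduces_to_def)
  show ?thesis using i(2) pos reduces by blast
qed

lemma reduces_to_uminus: "reduces_to n (\<lambda>k. - \<alpha> k) a b c \<longleftrightarrow> reduces_to n \<alpha> a b c"
  by (simp add: reduces_to_def pos_solution_def sum_negf)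

lemma three_variable_reduction:
  fixes \<alpha> :: "nat \<Rightarrow> int"
  assumes "n \<ge> 3" and nz: "\<forall>k\<in>{1..n}. \<alpha> k \<noteq> 0"
    and "\<exists>k\<in>{1..n}. \<alpha> k > 0" and "\<exists>k\<in>{1..n}. \<alpha> k < 0"
  shows "\<exists>a b c. a > 0 \<and> b > 0 \<and> c > 0 \<and> reduces_to n \<alpha> a b c"
proof -
  obtain i l where i: "i \<in> {1..n}" "\<alpha> i > 0" and l: "l \<in> {1..n}" "\<alpha> l < 0"
    using assms by blast
  have "card {i, l} < card {1..n}"
    using \<open>n \<ge> 3\<close> card_insert_le_m1[of 2 "{l}" i] by simp
  then have "\<not> {1..n} \<subseteq> {i, l}" using card_mono[of "{i, l}" "{1..n}"] by auto
  then obtain j where j: "j \<in> {1..n}" "j \<noteq> i" "j \<noteq> l" by blast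
  show ?thesis
  proof (cases "\<alpha> j > 0")
    case True
    with three_variable_reduction_two_pos[of i n \<alpha> j l] i j l nz show ?thesis by blast
  next
    case False
    then have "\<alpha> j < 0" using nz j by force
    \<comment> \<open>Negating the equation makes \<open>l\<close> and \<open>j\<close> the two
      indices with positive coefficient.\<close>
    with three_variable_reduction_two_pos[of l n "\<lambda>k. - \<alpha> k" j i] i j l nz show ?thesis
      by (simp add: reduces_to_uminus)
  qed
qed

lemma solution_free_if_no_solution_within:
  assumes red: "reduces_to n \<alpha> a b c"
    and none: "\<not> (\<exists>w. pos_solution n \<alpha> w \<and> (\<forall>i\<in>{1..n}. w i \<in> C))"
    and S: "\<And>k. k \<in> S \<Longrightarrow> k > 0 \<Longrightarrow> nat k \<in> C"
  shows "solution_free a b c S"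
  unfolding solution_free_def
proof (intro ballI impI notI)
  fix x y z assume *: "x \<in> S" "y \<in> S" "z \<in> S" "x > 0" "y > 0" "z > 0" "a * x + b * y = c * z"
  then obtain w where "pos_solution n \<alpha> w" "range w \<subseteq> {nat x, nat y, nat z}"
    using red[unfolded reduces_to_def, rule_format, of "nat x" "nat y" "nat z"] by auto
  moreover have "{nat x, nat y, nat z} \<subseteq> C" using * S by auto
  ultimately show False using none by blast
qed

theorem theorem1p1:
  fixes m n :: nat and a b :: "nat \<Rightarrow> int" and \<chi> :: "nat \<Rightarrow> nat"
  assumes "m \<ge> 3" and "n \<ge> 3"
    and "\<forall>i\<in>{1..m}. a i \<noteq> 0" and "\<forall>i\<in>{1..n}. b i \<noteq> 0"
    and "\<exists>i\<in>{1..m}. a i > 0" and "\<exists>i\<in>{1..m}. a i < 0"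
    and "\<exists>i\<in>{1..n}. b i > 0" and "\<exists>i\<in>{1..n}. b i < 0"
    and "\<chi> \<in> {k. k > 0} \<rightarrow> {0, 1}"
  shows "(\<exists>x. pos_solution m a x \<and> (\<forall>i\<in>{1..m}. \<chi> (x i) = 0)) \<or>
         (\<exists>x. pos_solution n b x \<and> (\<forall>i\<in>{1..n}. \<chi> (x i) = 1))"
proof (rule ccontr)
  assume none: "\<not> ?thesis"
  \<comment> \<open>All nonpositive integers get the color of \<open>0\<close> here; this is
    harmless, as \<open>solution_free\<close> tests positive entries only.\<close>
  define A where "A = {k. \<chi> (nat k) = 0}"
  have color1: "\<chi> (nat k) = 1" if "k \<in> - A" "k > 0" for k
    using that funcset_mem[OF assms(9), of "nat k"] by (simp add: A_def)
  obtain a1 a2 a3 where pos_a: "a1 > 0" "a2 > 0" "a3 > 0" and red_a: "reduces_to m a a1 a2 a3"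
    using three_variable_reduction[OF assms(1,3,5,6)] by blast
  obtain b1 b2 b3 where pos_b: "b1 > 0" "b2 > 0" "b3 > 0" and red_b: "reduces_to n b b1 b2 b3"
    using three_variable_reduction[OF assms(2,4,7,8)] by blast
  have "solution_free a1 a2 a3 A"
    by (rule solution_free_if_no_solution_within[OF red_a, of "{k. \<chi> k = 0}"])
      (use none in \<open>auto simp: A_def\<close>)
  moreover have "solution_free b1 b2 b3 (- A)"
    by (rule solution_free_if_no_solution_within[OF red_b, of "{k. \<chi> k = 1}"])
      (use none color1 in auto)
  ultimately show False using not_both_solution_free[OF pos_a pos_b] by blast
qed

end
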